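(* Let $p \in (0,\tfrac12]$ and let $f \in L^2(\{0,1\}^n,\mu_p)$. Suppose $f$ has $\beta$-small generalised influences, i.e. $\mathrm{I}_S(f) \le \beta\, \mathbb{E}_{\mu_p}[f^2]$ for all $S \subseteq [n]$. Then $\|\mathrm{T}_{1/5} f\|_4 \le \beta^{1/4}\|f\|_2$.
   Context: $\mu_p$ is the $p$-biased product measure on $\{0,1\}^n$ (each coordinate equals $1$ independently with probability $p$); all norms $\|\cdot\|_r$ are in $L^r(\{0,1\}^n,\mu_p)$. For $x \in \{0,1\}^n$ and $\rho\in[0,1]$, a sample $\mathbf{y}\sim N_\rho(x)$ is obtained by independently for each $i$ setting $\mathbf{y}_i = x_i$ with probability $\rho$ and otherwise resampling $\mathbf{y}_i$ with $\Pr[\mathbf{y}_i=1]=p$; the noise operator is $\mathrm{T}_\rho f(x) = \mathbb{E}_{\mathbf{y}\sim N_\rho(x)}[f(\mathbf{y})]$. For $S\subseteq[n]$ and $x\in\{0,1\}^S$, $f_{S\to x}$ is the function on $\{0,1\}^{[n]\setminus S}$ obtained by fixing the coordinates in $S$ according to $x$; $|x|$ is the number of ones in $x$. The generalised influence is $\mathrm{I}_S(f) = \mathbb{E}_{\mu_p}\big[\big(\sum_{x\in\{0,1\}^S}(-1)^{|S|-|x|} f_{S\to x}\big)^2\big]$. *)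

theory Defs
  imports "HOL-Probability.Probability"
begin

text \<open>
  For a finite index set \<open>I\<close>, a point of \<open>{0,1}\<^sup>I\<close> is a function that takes the value \<open>False\<close>
  outside \<open>I\<close>, with \<open>True\<close> for 1 and \<open>False\<close> for 0. A function on \<open>{0,1}\<^sup>I\<close> is represented by
  a function on all of \<open>'i \<Rightarrow> bool\<close>; the notions below only depend on its values on \<open>cube I\<close>.
  Every real function on the finite set \<open>cube I\<close> belongs to \<open>L\<^sup>2\<close>.
\<close>

definition cube :: "'i set \<Rightarrow> ('i \<Rightarrow> bool) set" where
  "cube I = PiE_dflt I False (\<lambda>_. UNIV)"

definition biased_measure :: "'i set \<Rightarrow> real \<Rightarrow> ('i \<Rightarrow> bool) pmf" where
  "biased_measure I p = Pi_pmf I False (\<lambda>_. bernoulli_pmf p)"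

definition lnorm :: "'i set \<Rightarrow> real \<Rightarrow> real \<Rightarrow> (('i \<Rightarrow> bool) \<Rightarrow> real) \<Rightarrow> real" where
  "lnorm I p r f =
     (measure_pmf.expectation (biased_measure I p) (\<lambda>x. \<bar>f x\<bar> powr r)) powr (1 / r)"

definition noise :: "'i set \<Rightarrow> real \<Rightarrow> real \<Rightarrow> ('i \<Rightarrow> bool) \<Rightarrow> ('i \<Rightarrow> bool) pmf" where
  "noise I p \<rho> x =
     Pi_pmf I False
       (\<lambda>i. bind_pmf (bernoulli_pmf \<rho>)
              (\<lambda>keep. if keep then return_pmf (x i) else bernoulli_pmf p))"

definition noise_operator ::
    "'i set \<Rightarrow> real \<Rightarrow> real \<Rightarrow> (('i \<Rightarrow> bool) \<Rightarrow> real) \<Rightarrow> ('i \<Rightarrow> bool) \<Rightarrow> real" where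
  "noise_operator I p \<rho> f x = measure_pmf.expectation (noise I p \<rho> x) f"

definition restriction ::
    "(('i \<Rightarrow> bool) \<Rightarrow> real) \<Rightarrow> 'i set \<Rightarrow> ('i \<Rightarrow> bool) \<Rightarrow> ('i \<Rightarrow> bool) \<Rightarrow> real" where
  "restriction f S x y = f (\<lambda>i. if i \<in> S then x i else y i)"

definition gen_influence ::
    "'i set \<Rightarrow> real \<Rightarrow> 'i set \<Rightarrow> (('i \<Rightarrow> bool) \<Rightarrow> real) \<Rightarrow> real" where
  "gen_influence I p S f =
     measure_pmf.expectation (biased_measure (I - S) p)
       (\<lambda>y. (\<Sum>x\<in>cube S. (-1) ^ (card S - card {i \<in> S. x i}) * restriction f S x y)\<^sup>2)"

definition small_gen_influences ::
    "'i set \<Rightarrow> real \<Rightarrow> real \<Rightarrow> (('i \<Rightarrow> bool) \<Rightarrow> real) \<Rightarrow> bool" where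
  "small_gen_influences I p \<beta> f \<longleftrightarrow>
     (\<forall>S\<subseteq>I. gen_influence I p S f
              \<le> \<beta> * measure_pmf.expectation (biased_measure I p) (\<lambda>x. (f x)\<^sup>2))"

end

theory Submission
  imports Defs
begin

text \<open>
  Write \<open>s = p (1 - p)\<close>. The heart of the matter is the bilinear inequality
  \<open>E[(T\<^sub>1\<^sub>/\<^sub>5 g)\<^sup>2 (T\<^sub>1\<^sub>/\<^sub>5 h)\<^sup>2] \<le> (\<Sum>S. s ^ |S| I\<^sub>S(T\<^sub>1\<^sub>/\<^sub>2 g) I\<^sub>S(T\<^sub>1\<^sub>/\<^sub>2 h))\<close>.
  Having two functions makes it tensorise: splitting off one coordinate reduces it to a polynomial
  inequality at each point and to four instances in one dimension less. For \<open>g = h = f\<close>, one factor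
  is at most \<open>I\<^sub>S(f) \<le> \<beta> E[f\<^sup>2]\<close>, while \<open>(\<Sum>S. s ^ |S| I\<^sub>S(T\<^sub>1\<^sub>/\<^sub>2 f)) \<le> E[f\<^sup>2]\<close>, because every
  Fourier coefficient of \<open>f\<close> of degree \<open>d\<close> is counted with weight \<open>2\<^sup>d (1/2)\<^sup>2\<^sup>d \<le> 1\<close>.
\<close>

section \<open>Splitting one coordinate off the product measure\<close>

definition coord_mean :: "'i \<Rightarrow> real \<Rightarrow> (('i \<Rightarrow> bool) \<Rightarrow> real) \<Rightarrow> ('i \<Rightarrow> bool) \<Rightarrow> real" where
  "coord_mean i p f x = p * f (x(i := True)) + (1 - p) * f (x(i := False))"

text \<open>The discrete derivative in direction \<open>i\<close>. With \<open>coord_mean\<close> it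
  gives the decomposition f(x) = \<open>coord_mean i p f x\<close> + (x_i - p) *
  \<open>coord_diff i f x\<close>; under the biased measure the factor x_i - p has mean 0 and
  variance p (1 - p).\<close>

definition coord_diff :: "'i \<Rightarrow> (('i \<Rightarrow> bool) \<Rightarrow> real) \<Rightarrow> ('i \<Rightarrow> bool) \<Rightarrow> real" where
  "coord_diff i f x = f (x(i := True)) - f (x(i := False))"

lemma finite_set_Pi_pmf_bool:
  fixes q :: "'i \<Rightarrow> bool pmf"
  assumes "finite I"
  shows "finite (set_pmf (Pi_pmf I False q))"
  unfolding set_Pi_pmf[OF assms] using assms by (rule finite_PiE_dflt) simp

lemma integrable_Pi_pmf_bool [simp]:
  fixes F :: "('i \<Rightarrow> bool) \<Rightarrow> real"
  assumes "finite I"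
  shows "integrable (measure_pmf (Pi_pmf I False q)) F"
  using finite_set_Pi_pmf_bool[OF assms] by (rule integrable_measure_pmf_finite)

lemma expectation_Pi_pmf_bool_insert:
  fixes F :: "('i \<Rightarrow> bool) \<Rightarrow> real"
  assumes "finite I" "i \<notin> I"
  shows "measure_pmf.expectation (Pi_pmf (insert i I) False q) F =
    pmf (q i) True * measure_pmf.expectation (Pi_pmf I False q) (\<lambda>x. F (x(i := True))) +
    pmf (q i) False * measure_pmf.expectation (Pi_pmf I False q) (\<lambda>x. F (x(i := False)))"
proof -
  have "Pi_pmf (insert i I) False q =
      bind_pmf (q i) (\<lambda>b. map_pmf (\<lambda>x. x(i := b)) (Pi_pmf I False q))"
    by (subst Pi_pmf_insert') (simp_all add: assms map_pmf_def)
  then have "measure_pmf.expectation (Pi_pmf (insert i I) False q) F =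
      (\<Sum>b\<in>UNIV. pmf (q i) b *\<^sub>R
        measure_pmf.expectation (map_pmf (\<lambda>x. x(i := b)) (Pi_pmf I False q)) F)"
    using assms
    by (simp only:) (subst pmf_expectation_bind[of UNIV], simp_all add: finite_set_Pi_pmf_bool)
  then show ?thesis
    by (simp add: UNIV_bool)
qed

lemma integrable_biased_measure [simp]:
  fixes F :: "('i \<Rightarrow> bool) \<Rightarrow> real"
  assumes "finite I"
  shows "integrable (measure_pmf (biased_measure I p)) F"
  by (simp add: biased_measure_def assms)

lemma expectation_biased_insert:
  fixes F :: "('i \<Rightarrow> bool) \<Rightarrow> real"
  assumes "finite I" "i \<notin> I" "p \<in> {0..1}"
  shows "measure_pmf.expectation (biased_measure (insert i I) p) F =
    measure_pmf.expectation (biased_measure I p) (coord_mean i p F)"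
  unfolding biased_measure_def coord_mean_def
  using assms by (simp add: expectation_Pi_pmf_bool_insert)

text \<open>Pythagoras in the coordinate \<open>i\<close>: the mean part and the multiple of x_i - p
  are orthogonal, and p (1 - p) is the squared norm of x_i - p.\<close>

lemma expectation_biased_insert_square:
  fixes F :: "('i \<Rightarrow> bool) \<Rightarrow> real"
  assumes "finite I" "i \<notin> I" "p \<in> {0..1}"
  shows "measure_pmf.expectation (biased_measure (insert i I) p) (\<lambda>x. (F x)\<^sup>2) =
    measure_pmf.expectation (biased_measure I p) (\<lambda>x. (coord_mean i p F x)\<^sup>2) +
    p * (1 - p) * measure_pmf.expectation (biased_measure I p) (\<lambda>x. (coord_diff i F x)\<^sup>2)"
proof -
  have "coord_mean i p (\<lambda>x. (F x)\<^sup>2) =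
      (\<lambda>x. (coord_mean i p F x)\<^sup>2 + p * (1 - p) * (coord_diff i F x)\<^sup>2)"
    by (rule ext) (simp add: coord_mean_def coord_diff_def power2_eq_square algebra_simps)
  then show ?thesis
    using assms by (simp add: expectation_biased_insert)
qed

section \<open>The noise operator, one coordinate at a time\<close>

lemma noise_operator_empty: "noise_operator {} p \<rho> f = (\<lambda>_. f (\<lambda>_. False))"
  by (rule ext) (simp add: noise_operator_def noise_def)

lemma noise_fun_upd: "i \<notin> I \<Longrightarrow> noise I p \<rho> (x(i := b)) = noise I p \<rho> x"
  unfolding noise_def by (intro Pi_pmf_cong refl) (metis fun_upd_other)

text \<open>The resampled bit equals 1 with probability p + \<rho> (x_i - p). Hence noise in the
  coordinate \<open>i\<close> fixes the mean part and multiplies the centred factor x_i - p by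
  \<rho>.\<close>

lemma noise_operator_insert:
  fixes f :: "('i \<Rightarrow> bool) \<Rightarrow> real"
  assumes "finite I" "i \<notin> I" "p \<in> {0..1}" "\<rho> \<in> {0..1}"
  shows "noise_operator (insert i I) p \<rho> f x =
    noise_operator I p \<rho> (coord_mean i p f) x +
    \<rho> * (of_bool (x i) - p) * noise_operator I p \<rho> (coord_diff i f) x"
proof -
  let ?q = "bind_pmf (bernoulli_pmf \<rho>)
    (\<lambda>keep. if keep then return_pmf (x i) else bernoulli_pmf p)"
  let ?E = "\<lambda>b. measure_pmf.expectation (noise I p \<rho> x) (\<lambda>y. f (y(i := b)))"
  have "pmf ?q True = \<rho> * of_bool (x i) + (1 - \<rho>) * p"
    and "pmf ?q False = \<rho> * (1 - of_bool (x i)) + (1 - \<rho>) * (1 - p)"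
    using assms by (auto simp: pmf_bind)
  then have "noise_operator (insert i I) p \<rho> f x =
      (\<rho> * of_bool (x i) + (1 - \<rho>) * p) * ?E True +
      (\<rho> * (1 - of_bool (x i)) + (1 - \<rho>) * (1 - p)) * ?E False"
    using assms
    by (simp add: noise_operator_def noise_def expectation_Pi_pmf_bool_insert)
  moreover have "noise_operator I p \<rho> (coord_mean i p f) x = p * ?E True + (1 - p) * ?E False"
    and "noise_operator I p \<rho> (coord_diff i f) x = ?E True - ?E False"
    unfolding noise_operator_def coord_mean_def coord_diff_def
    using assms by (simp_all add: noise_def)
  ultimately show ?thesis
    by (simp only:) (simp add: algebra_simps)
qed

lemma noise_operator_fun_upd:
  "i \<notin> I \<Longrightarrow> noise_operator I p \<rho> f (x(i := b)) = noise_operator I p \<rho> f x"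
  by (simp add: noise_operator_def noise_fun_upd)

lemma coord_noise_operator:
  fixes f :: "('i \<Rightarrow> bool) \<Rightarrow> real"
  assumes "finite I" "i \<notin> I" "p \<in> {0..1}" "\<rho> \<in> {0..1}"
  shows coord_mean_noise_operator: "coord_mean i p (noise_operator (insert i I) p \<rho> f) =
      noise_operator I p \<rho> (coord_mean i p f)"
    and coord_diff_noise_operator: "coord_diff i (noise_operator (insert i I) p \<rho> f) =
      (\<lambda>x. \<rho> * noise_operator I p \<rho> (coord_diff i f) x)"
  by (rule ext, simp add: coord_mean_def[of _ _ "noise_operator _ _ _ _"]
      coord_diff_def[of _ "noise_operator _ _ _ _"] noise_operator_insert[OF assms]
      noise_operator_fun_upd[OF assms(2)] algebra_simps)+

section \<open>Generalised influences, one coordinate at a time\<close>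

text \<open>The iterated discrete derivative in all directions of \<open>S\<close>, written as the
  signed sum inside \<open>gen_influence\<close>; a generalised influence is its second
  moment.\<close>

definition cube_derivative ::
    "'i set \<Rightarrow> (('i \<Rightarrow> bool) \<Rightarrow> real) \<Rightarrow> ('i \<Rightarrow> bool) \<Rightarrow> real" where
  "cube_derivative S f y =
    (\<Sum>x\<in>cube S. (-1) ^ (card S - card {i \<in> S. x i}) * restriction f S x y)"

lemma gen_influence_eq:
  "gen_influence I p S f =
    measure_pmf.expectation (biased_measure (I - S) p) (\<lambda>y. (cube_derivative S f y)\<^sup>2)"
  by (simp add: gen_influence_def cube_derivative_def)

lemma gen_influence_nonneg: "gen_influence I p S f \<ge> 0"
  unfolding gen_influence_def by (rule integral_nonneg_AE) simp

lemma cube_empty: "cube {} = {\<lambda>_. False}"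
  by (auto simp: cube_def PiE_dflt_def)

lemma gen_influence_empty:
  "gen_influence I p {} f = measure_pmf.expectation (biased_measure I p) (\<lambda>x. (f x)\<^sup>2)"
  by (simp add: gen_influence_def cube_empty restriction_def)

lemma gen_influence_scale: "gen_influence I p S (\<lambda>x. c * f x) = c\<^sup>2 * gen_influence I p S f"
proof -
  have "cube_derivative S (\<lambda>x. c * f x) = (\<lambda>y. c * cube_derivative S f y)"
    by (rule ext) (simp add: cube_derivative_def restriction_def sum_distrib_left algebra_simps)
  then show ?thesis
    by (simp add: gen_influence_eq power_mult_distrib)
qed

text \<open>Both operators are linear and touch only the coordinate \<open>i\<close>, which the
  derivative along \<open>S\<close> leaves free, so they commute with it.\<close>

lemma coord_cube_derivative:
  assumes "i \<notin> S"
  shows coord_mean_cube_derivative: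
      "coord_mean i p (cube_derivative S f) = cube_derivative S (coord_mean i p f)"
    and coord_diff_cube_derivative:
      "coord_diff i (cube_derivative S f) = cube_derivative S (coord_diff i f)"
proof -
  have upd: "restriction f S x (y(i := b)) = f ((\<lambda>j. if j \<in> S then x j else y j)(i := b))"
    for f :: "('a \<Rightarrow> bool) \<Rightarrow> real" and x y b
    unfolding restriction_def by (rule arg_cong[of _ _ f]) (use assms in \<open>auto simp: fun_eq_iff\<close>)
  show "coord_mean i p (cube_derivative S f) = cube_derivative S (coord_mean i p f)"
    by (rule ext) (simp add: coord_mean_def cube_derivative_def upd sum_distrib_left
        sum.distrib[symmetric] restriction_def[of "coord_mean i p f"] algebra_simps)
  show "coord_diff i (cube_derivative S f) = cube_derivative S (coord_diff i f)"
    by (rule ext) (simp add: coord_diff_def cube_derivative_def upd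
        sum_subtractf[symmetric] restriction_def[of "coord_diff i f"] algebra_simps)
qed

text \<open>Here \<open>i\<close> is still averaged over, so Pythagoras in that coordinate applies
  to the derivative along \<open>S\<close>.\<close>

lemma gen_influence_insert_notin:
  assumes "finite I" "i \<notin> I" "S \<subseteq> I" "p \<in> {0..1}"
  shows "gen_influence (insert i I) p S f =
    gen_influence I p S (coord_mean i p f) + p * (1 - p) * gen_influence I p S (coord_diff i f)"
proof -
  have "i \<notin> S" "insert i I - S = insert i (I - S)"
    using assms by auto
  then show ?thesis
    using assms by (simp add: gen_influence_eq expectation_biased_insert_square
        coord_cube_derivative)
qed

lemma cube_insert:
  assumes "i \<notin> S"
  shows "cube (insert i S) = cube S \<union> (\<lambda>x. x(i := True)) ` cube S" (is "?L = ?R")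
proof
  show "?R \<subseteq> ?L"
    by (auto simp: cube_def PiE_dflt_def)
  show "?L \<subseteq> ?R"
  proof
    fix x assume x: "x \<in> ?L"
    show "x \<in> ?R"
    proof (cases "x i")
      case True
      then have "x = (x(i := False))(i := True)"
        by (simp add: fun_upd_idem)
      moreover have "x(i := False) \<in> cube S"
        using x by (auto simp: cube_def PiE_dflt_def)
      ultimately show ?thesis
        by blast
    next
      case False
      then show ?thesis
        using x by (auto simp: cube_def PiE_dflt_def)
    qed
  qed
qed

text \<open>The points of the larger cube are paired by flipping \<open>i\<close>; the two members
  of a pair carry opposite signs, and together they form a difference in direction
  \<open>i\<close>.\<close>

lemma cube_derivative_insert:
  assumes "finite S" "i \<notin> S"
  shows "cube_derivative (insert i S) f = cube_derivative S (coord_diff i f)"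
proof
  fix y
  \<comment> \<open>The default value \<open>False\<close> makes \<open>cube S\<close> itself the
    half of the larger cube on which coordinate \<open>i\<close> is 0.\<close>
  have off: "\<not> x i" if "x \<in> cube S" for x
    using that assms by (auto simp: cube_def PiE_dflt_def)
  have inj: "inj_on (\<lambda>x. x(i := True)) (cube S)"
  proof (rule inj_on_inverseI)
    fix x assume "x \<in> cube S"
    then show "(x(i := True))(i := False) = x"
      using off[of x] by (simp add: fun_upd_idem)
  qed
  have fin: "finite (cube S)"
    unfolding cube_def by (rule finite_PiE_dflt) (use assms in simp_all)
  have r: "restriction f (insert i S) (x(i := b)) y = f ((\<lambda>j. if j \<in> S then x j else y j)(i := b))"
    for x b
    unfolding restriction_def by (rule arg_cong[of _ _ f]) (use assms in \<open>auto simp: fun_eq_iff\<close>)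
  have r0: "restriction f (insert i S) x y = f ((\<lambda>j. if j \<in> S then x j else y j)(i := False))"
    if "x \<in> cube S" for x
    using r[of x False] off[OF that] by (simp add: fun_upd_idem)
  have disj: "cube S \<inter> (\<lambda>x. x(i := True)) ` cube S = {}"
    by (auto dest: off)
  \<comment> \<open>Rules out truncation in the natural subtraction of the exponent, so that it
    grows by exactly one on the half with coordinate \<open>i\<close> equal to 0.\<close>
  have le: "card {j \<in> S. x j} \<le> card S" for x
    using assms by (intro card_mono) auto
  have exp0: "card (insert i S) - card {j \<in> insert i S. x j} = Suc (card S - card {j \<in> S. x j})"
    if "x \<in> cube S" for x
  proof -
    have "{j \<in> insert i S. x j} = {j \<in> S. x j}"
      using off[OF that] by auto
    then show ?thesis
      using assms le[of x] by (simp add: Suc_diff_le)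
  qed
  have exp1: "card (insert i S) - card {j \<in> insert i S. (x(i := True)) j} =
      card S - card {j \<in> S. x j}" for x
  proof -
    have "{j \<in> insert i S. (x(i := True)) j} = insert i {j \<in> S. x j}"
      by auto
    then show ?thesis
      using assms by simp
  qed
  have "cube_derivative (insert i S) f y =
      (\<Sum>x\<in>cube S. (-1) ^ (card (insert i S) - card {j \<in> insert i S. x j}) *
         restriction f (insert i S) x y) +
      (\<Sum>x\<in>cube S. (-1) ^ (card (insert i S) - card {j \<in> insert i S. (x(i := True)) j}) *
         restriction f (insert i S) (x(i := True)) y)"
    unfolding cube_derivative_def cube_insert[OF assms(2)]
      sum.union_disjoint[OF fin finite_imageI[OF fin] disj] sum.reindex[OF inj] o_def
    by (rule refl)
  also have "\<dots> = (\<Sum>x\<in>cube S. (-1) ^ (card S - card {j \<in> S. x j}) *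
      (f ((\<lambda>j. if j \<in> S then x j else y j)(i := True)) -
       f ((\<lambda>j. if j \<in> S then x j else y j)(i := False))))"
    unfolding sum.distrib[symmetric] exp1 r
    by (intro sum.cong refl, simp only: exp0 r0) (simp add: algebra_simps)
  also have "\<dots> = cube_derivative S (coord_diff i f) y"
    by (simp add: cube_derivative_def restriction_def coord_diff_def)
  finally show "cube_derivative (insert i S) f y = cube_derivative S (coord_diff i f) y" .
qed

lemma gen_influence_insert_in:
  assumes "finite I" "i \<notin> I" "S \<subseteq> I"
  shows "gen_influence (insert i I) p (insert i S) f = gen_influence I p S (coord_diff i f)"
proof -
  have "insert i I - insert i S = I - S" "finite S" "i \<notin> S"
    using assms finite_subset by auto
  then show ?thesis
    by (simp add: gen_influence_eq cube_derivative_insert)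
qed

text \<open>Noise scales the difference in direction \<open>i\<close> by \<rho>, and influences are
  quadratic, which produces \<rho> squared.\<close>

lemma gen_influence_noise_insert:
  assumes "finite I" "i \<notin> I" "S \<subseteq> I" "p \<in> {0..1}" "\<rho> \<in> {0..1}"
  shows gen_influence_noise_insert_notin:
      "gen_influence (insert i I) p S (noise_operator (insert i I) p \<rho> f) =
        gen_influence I p S (noise_operator I p \<rho> (coord_mean i p f)) +
        p * (1 - p) * (\<rho>\<^sup>2 * gen_influence I p S (noise_operator I p \<rho> (coord_diff i f)))"
    and gen_influence_noise_insert_in:
      "gen_influence (insert i I) p (insert i S) (noise_operator (insert i I) p \<rho> f) =
        \<rho>\<^sup>2 * gen_influence I p S (noise_operator I p \<rho> (coord_diff i f))"
  using assms by (simp_all add: gen_influence_insert_notin gen_influence_insert_in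
      coord_noise_operator gen_influence_scale)

text \<open>Coordinate by coordinate, noise keeps the mean part and multiplies the difference part
  by \<rho> squared, which is at most 1.\<close>

lemma gen_influence_noise_le:
  assumes "finite I" "S \<subseteq> I" "p \<in> {0..1}" "\<rho> \<in> {0..1}"
  shows "gen_influence I p S (noise_operator I p \<rho> f) \<le> gen_influence I p S f"
  using assms(1,2)
proof (induction I arbitrary: S f rule: finite_induct)
  case empty
  then show ?case
    by (simp add: gen_influence_empty noise_operator_empty biased_measure_def)
next
  case (insert i I)
  have rho: "\<rho>\<^sup>2 \<le> 1"
    using assms(4) by (simp add: power_le_one)
  have diff: "\<rho>\<^sup>2 * gen_influence I p S (noise_operator I p \<rho> (coord_diff i f))
      \<le> gen_influence I p S (coord_diff i f)" if "S \<subseteq> I" for S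
    using mult_mono[OF rho insert.IH[OF that]] by (simp add: gen_influence_nonneg)
  show ?case
  proof (cases "i \<in> S")
    case True
    then obtain S' where S': "S = insert i S'" "S' \<subseteq> I"
      using insert.prems by (metis Diff_subset_conv insert_Diff insert_is_Un)
    show ?thesis
      unfolding S'(1)
      by (subst gen_influence_noise_insert_in[OF insert.hyps S'(2) assms(3,4)],
          subst gen_influence_insert_in[OF insert.hyps S'(2)], rule diff[OF S'(2)])
  next
    case False
    then have S: "S \<subseteq> I"
      using insert.prems by auto
    show ?thesis
      by (subst gen_influence_noise_insert_notin[OF insert.hyps S assms(3,4)],
          subst gen_influence_insert_notin[OF insert.hyps S assms(3)],
          intro add_mono mult_left_mono insert.IH diff S)
        (use assms(3) in auto)
  qed
qed

section \<open>The weighted sum of noisy influences\<close>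

lemma sum_Pow_insert:
  assumes "finite I" "i \<notin> I"
  shows "sum F (Pow (insert i I)) = (\<Sum>S\<in>Pow I. F S + F (insert i S))"
proof -
  have "inj_on (insert i) (Pow I)"
    using assms by (auto simp: inj_on_def)
  then show ?thesis
    unfolding Pow_insert using assms
    by (subst sum.union_disjoint) (auto simp: sum.reindex sum.distrib)
qed

text \<open>Induction replaces the Fourier expansion. The difference part in direction
  \<open>i\<close> is counted twice, through \<open>S\<close> as a variance and through
  \<open>insert i S\<close> as a derivative, each time with weight p (1 - p) \<rho>^2; the condition
  on \<rho> absorbs the factor 2.\<close>

lemma sum_gen_influence_noise_le:
  fixes \<rho> :: real
  assumes "finite I" "p \<in> {0..1}" "\<rho> \<in> {0..1}" "2 * \<rho>\<^sup>2 \<le> 1"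
  shows "(\<Sum>S\<in>Pow I. (p * (1 - p)) ^ card S * gen_influence I p S (noise_operator I p \<rho> f))
    \<le> measure_pmf.expectation (biased_measure I p) (\<lambda>x. (f x)\<^sup>2)"
  using assms(1)
proof (induction I arbitrary: f rule: finite_induct)
  case empty
  then show ?case
    by (simp add: gen_influence_empty noise_operator_empty biased_measure_def)
next
  case (insert i I)
  let ?s = "p * (1 - p)"
  let ?W = "\<lambda>S f. gen_influence I p S (noise_operator I p \<rho> f)"
  let ?R = "\<lambda>f. \<Sum>S\<in>Pow I. ?s ^ card S * ?W S f"
  have s: "0 \<le> ?s"
    using assms(2) by simp
  have R: "0 \<le> ?R f" for f
    by (intro sum_nonneg mult_nonneg_nonneg gen_influence_nonneg zero_le_power[OF s])
  have "(\<Sum>S\<in>Pow (insert i I). ?s ^ card S *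
      gen_influence (insert i I) p S (noise_operator (insert i I) p \<rho> f)) =
      (\<Sum>S\<in>Pow I. ?s ^ card S * ?W S (coord_mean i p f) +
        2 * \<rho>\<^sup>2 * ?s * (?s ^ card S * ?W S (coord_diff i f)))"
    unfolding sum_Pow_insert[OF insert.hyps]
  proof (rule sum.cong)
    fix S assume "S \<in> Pow I"
    then have "S \<subseteq> I" "finite S" "i \<notin> S"
      using insert.hyps finite_subset by auto
    then show "?s ^ card S *
        gen_influence (insert i I) p S (noise_operator (insert i I) p \<rho> f) +
        ?s ^ card (insert i S) *
        gen_influence (insert i I) p (insert i S) (noise_operator (insert i I) p \<rho> f) =
        ?s ^ card S * ?W S (coord_mean i p f) +
        2 * \<rho>\<^sup>2 * ?s * (?s ^ card S * ?W S (coord_diff i f))"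
      using insert.hyps assms(2,3)
      by (simp add: gen_influence_noise_insert[OF insert.hyps]) (simp add: algebra_simps)
  qed simp
  also have "\<dots> = ?R (coord_mean i p f) + 2 * \<rho>\<^sup>2 * (?s * ?R (coord_diff i f))"
    by (simp only: sum.distrib sum_distrib_left mult.assoc)
  also have "\<dots> \<le> ?R (coord_mean i p f) + ?s * ?R (coord_diff i f)"
    using mult_right_mono[OF assms(4) mult_nonneg_nonneg[OF s R]] by simp
  also have "\<dots> \<le> measure_pmf.expectation (biased_measure I p) (\<lambda>x. (coord_mean i p f x)\<^sup>2) +
      ?s * measure_pmf.expectation (biased_measure I p) (\<lambda>x. (coord_diff i f x)\<^sup>2)"
    using s by (intro add_mono mult_left_mono insert.IH)
  also have "\<dots> = measure_pmf.expectation (biased_measure (insert i I) p) (\<lambda>x. (f x)\<^sup>2)"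
    using insert.hyps assms(2) by (simp add: expectation_biased_insert_square)
  finally show ?case .
qed

section \<open>The two-point inequality and its tensorisation\<close>

text \<open>The one-coordinate case of the bilinear inequality: \<open>u0\<close>, \<open>u1\<close>
  stand for the mean and difference parts of one function and \<open>v0\<close>, \<open>v1\<close>
  for those of the other. On the right, 1/4 and 1/16 are the second and fourth powers of the rate
  1/2.\<close>

lemma two_point_inequality:
  fixes p u0 u1 v0 v1 :: real
  assumes "p \<in> {0..1}"
  shows "p * ((u0 + (1 - p) * u1 / 5)\<^sup>2 * (v0 + (1 - p) * v1 / 5)\<^sup>2) +
      (1 - p) * ((u0 - p * u1 / 5)\<^sup>2 * (v0 - p * v1 / 5)\<^sup>2)
    \<le> u0\<^sup>2 * v0\<^sup>2 + p * (1 - p) / 4 * (u0\<^sup>2 * v1\<^sup>2 + u1\<^sup>2 * v0\<^sup>2) +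
      p * (1 - p) / 16 * (u1\<^sup>2 * v1\<^sup>2)" (is "?L \<le> ?R")
proof -
  \<comment> \<open>All terms besides u0^2 v0^2 become quadratic in these three products, because
    (u0 v0)(u1 v1) = a b.\<close>
  define a b c where abc: "a = u0 * v1" "b = u1 * v0" "c = u1 * v1"
  define s where "s = p * (1 - p)"
  \<comment> \<open>The left side will turn out to be u0^2 v0^2 + s B, so it suffices to bound
    \<open>B\<close>.\<close>
  define B where "B = (a\<^sup>2 + b\<^sup>2 + 4 * a * b) / 25 + 2 * (1 - 2 * p) * (a * c + b * c) / 125 +
    (1 - 3 * s) * c\<^sup>2 / 625"
  have s: "0 \<le> s"
    using assms by (simp add: s_def)
  have cross: "2 * (1 - 2 * p) * (x * c) \<le> x\<^sup>2 + c\<^sup>2" for x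
  proof -
    have "2 * (1 - 2 * p) * (x * c) \<le> \<bar>2 * (1 - 2 * p) * (x * c)\<bar>"
      by (rule abs_ge_self)
    also have "\<dots> = 2 * \<bar>1 - 2 * p\<bar> * \<bar>x * c\<bar>"
      by (simp only: abs_mult abs_numeral)
    also have "\<dots> \<le> 2 * 1 * \<bar>x * c\<bar>"
      using assms by (intro mult_right_mono mult_left_mono) auto
    also have "\<dots> \<le> x\<^sup>2 + c\<^sup>2"
      using sum_squares_bound[of "\<bar>x\<bar>" "\<bar>c\<bar>"] by (simp add: abs_mult)
    finally show ?thesis .
  qed
  have "B \<le> (a\<^sup>2 + b\<^sup>2) / 4 + c\<^sup>2 / 16"
  proof -
    have "4 * a * b \<le> 2 * (a\<^sup>2 + b\<^sup>2)"
      using sum_squares_bound[of a b] by simp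
    moreover have "(1 - 3 * s) * c\<^sup>2 \<le> c\<^sup>2"
      using s mult_right_mono[of "1 - 3 * s" 1 "c\<^sup>2"] by simp
    \<comment> \<open>The constants have room to spare: \<open>A\<close> and \<open>B\<close>
      collect 3/25 + 1/125 = 16/125, below 1/4, and \<open>C\<close> collects 2/125 + 1/625 =
      11/625, below 1/16.\<close>
    moreover have "(A + B + P) / 25 + (X + Y) / 125 + Z / 625 \<le> (A + B) / 4 + C / 16"
      if "P \<le> 2 * (A + B)" "Z \<le> C" "X \<le> A + C" "Y \<le> B + C" "0 \<le> A" "0 \<le> B" "0 \<le> C"
      for A B C P X Y Z :: real
      using that by (simp add: field_simps)
    ultimately show ?thesis
      unfolding B_def distrib_left[of "2 * (1 - 2 * p)"] using cross zero_le_power2 by blast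
  qed
  then have "s * B \<le> s * ((a\<^sup>2 + b\<^sup>2) / 4 + c\<^sup>2 / 16)"
    using s by (rule mult_left_mono)
  moreover have "?L = u0\<^sup>2 * v0\<^sup>2 + s * B"
  proof -
    define k l m where klm: "k = u0 * v0" "l = (a + b) / 5" "m = c / 25"
    have prod: "(u0 + t * u1 / 5)\<^sup>2 * (v0 + t * v1 / 5)\<^sup>2 = (k + t * l + t\<^sup>2 * m)\<^sup>2" for t
      unfolding power_mult_distrib[symmetric] klm abc
      by (rule arg_cong[of _ _ "\<lambda>x. x\<^sup>2"]) (simp add: power2_eq_square field_simps)
    \<comment> \<open>Here t is the centred bit x_i - p, with moments E[t] = 0, E[t^2] = s, E[t^3] =
      s (1 - 2p) and E[t^4] = s (1 - 3s).\<close>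
    have moments: "p * (k + (1 - p) * l + (1 - p)\<^sup>2 * m)\<^sup>2 +
        (1 - p) * (k + - p * l + (- p)\<^sup>2 * m)\<^sup>2 =
        k\<^sup>2 + s * (l\<^sup>2 + 2 * k * m + 2 * (1 - 2 * p) * l * m + (1 - 3 * s) * m\<^sup>2)"
      by (simp add: s_def power2_eq_square algebra_simps)
    have km: "k * m = a * b / 25"
      by (simp add: klm abc)
    have "l\<^sup>2 + 2 * k * m + 2 * (1 - 2 * p) * l * m + (1 - 3 * s) * m\<^sup>2 = B"
      unfolding mult.assoc km unfolding klm B_def by (simp add: power2_eq_square field_simps)
    moreover have "k\<^sup>2 = u0\<^sup>2 * v0\<^sup>2"
      by (simp add: klm power_mult_distrib)
    ultimately show ?thesis
      using prod[of "1 - p"] prod[of "- p"] moments by simp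
  qed
  moreover have "?R = u0\<^sup>2 * v0\<^sup>2 + s * ((a\<^sup>2 + b\<^sup>2) / 4 + c\<^sup>2 / 16)"
    unfolding abc s_def by algebra
  ultimately show ?thesis
    by simp
qed

text \<open>Even when \<open>g\<close> and \<open>h\<close> coincide, the induction step meets the
  mixed pair of a mean part and a difference part, so both functions stay arbitrary in the
  induction.\<close>

lemma noise_product_le_sum_gen_influence:
  fixes g h :: "('i \<Rightarrow> bool) \<Rightarrow> real"
  assumes "finite I" "p \<in> {0..1}"
  shows "measure_pmf.expectation (biased_measure I p)
      (\<lambda>x. (noise_operator I p (1 / 5) g x)\<^sup>2 * (noise_operator I p (1 / 5) h x)\<^sup>2)
    \<le> (\<Sum>S\<in>Pow I. (p * (1 - p)) ^ card S *
        (gen_influence I p S (noise_operator I p (1 / 2) g) *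
         gen_influence I p S (noise_operator I p (1 / 2) h)))"
  using assms(1)
proof (induction I arbitrary: g h rule: finite_induct)
  case empty
  then show ?case
    by (simp add: gen_influence_empty noise_operator_empty biased_measure_def)
next
  case (insert i I)
  let ?s = "p * (1 - p)"
  let ?E = "measure_pmf.expectation (biased_measure I p)"
  let ?T = "noise_operator I p (1 / 5)"
  let ?T' = "noise_operator (insert i I) p (1 / 5)"
  let ?W = "\<lambda>S f. gen_influence I p S (noise_operator I p (1 / 2) f)"
  let ?W' = "\<lambda>S f. gen_influence (insert i I) p S (noise_operator (insert i I) p (1 / 2) f)"
  let ?P = "\<lambda>g h. ?E (\<lambda>x. (?T g x)\<^sup>2 * (?T h x)\<^sup>2)"
  let ?R = "\<lambda>g h. \<Sum>S\<in>Pow I. ?s ^ card S * (?W S g * ?W S h)"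
  let ?m = "coord_mean i p" and ?d = "coord_diff i"
  have s: "0 \<le> ?s"
    using assms(2) by simp
  note T = noise_operator_insert[OF insert.hyps assms(2), of "1 / 5"]
  have "measure_pmf.expectation (biased_measure (insert i I) p)
      (\<lambda>x. (?T' g x)\<^sup>2 * (?T' h x)\<^sup>2) =
      ?E (\<lambda>x.
        p * ((?T (?m g) x + (1 - p) * ?T (?d g) x / 5)\<^sup>2 *
             (?T (?m h) x + (1 - p) * ?T (?d h) x / 5)\<^sup>2) +
        (1 - p) * ((?T (?m g) x - p * ?T (?d g) x / 5)\<^sup>2 *
             (?T (?m h) x - p * ?T (?d h) x / 5)\<^sup>2))"
    unfolding expectation_biased_insert[OF insert.hyps assms(2)]
    by (rule arg_cong[of _ _ ?E], rule ext)
      (simp add: coord_mean_def[of _ _ "\<lambda>x. _ x * _ x"] T noise_operator_fun_upd[OF insert.hyps(2)])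
  \<comment> \<open>The two-point inequality holds at each point x of the smaller cube and is then
    integrated.\<close>
  also have "\<dots> \<le> ?E (\<lambda>x. (?T (?m g) x)\<^sup>2 * (?T (?m h) x)\<^sup>2 +
      ?s / 4 * ((?T (?m g) x)\<^sup>2 * (?T (?d h) x)\<^sup>2 + (?T (?d g) x)\<^sup>2 * (?T (?m h) x)\<^sup>2) +
      ?s / 16 * ((?T (?d g) x)\<^sup>2 * (?T (?d h) x)\<^sup>2))"
    using insert.hyps by (intro integral_mono two_point_inequality assms(2)) simp_all
  also have "\<dots> = ?P (?m g) (?m h) + ?s / 4 * (?P (?m g) (?d h) + ?P (?d g) (?m h)) +
      ?s / 16 * ?P (?d g) (?d h)"
    using insert.hyps by simp
  also have "\<dots> \<le> ?R (?m g) (?m h) + ?s / 4 * (?R (?m g) (?d h) + ?R (?d g) (?m h)) +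
      ?s / 16 * ?R (?d g) (?d h)"
    using s by (intro add_mono mult_left_mono insert.IH) auto
  also have "\<dots> = (\<Sum>S\<in>Pow I. ?s ^ card S *
      (?W S (?m g) * ?W S (?m h) +
       ?s / 4 * (?W S (?m g) * ?W S (?d h) + ?W S (?d g) * ?W S (?m h)) +
       ?s / 16 * (?W S (?d g) * ?W S (?d h))))"
    by (simp add: sum_distrib_left sum.distrib[symmetric] algebra_simps)
  \<comment> \<open>The 1/16 term comes from \<open>insert i S\<close>, the other terms from
    \<open>S\<close>; all that is lost is the nonnegative product of the two variance terms, of
    order (s/4)^2.\<close>
  also have "\<dots> \<le> (\<Sum>S\<in>Pow I. ?s ^ card S * (?W' S g * ?W' S h) +
      ?s ^ card (insert i S) * (?W' (insert i S) g * ?W' (insert i S) h))"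
  proof (rule sum_mono)
    fix S assume "S \<in> Pow I"
    then have S: "S \<subseteq> I" "finite S" "i \<notin> S"
      using insert.hyps finite_subset by auto
    have W': "?W' S f = ?W S (?m f) + ?s / 4 * ?W S (?d f)"
      "?W' (insert i S) f = ?W S (?d f) / 4" for f
      using gen_influence_noise_insert[OF insert.hyps S(1) assms(2), of "1 / 2"]
      by (simp_all add: power2_eq_square)
    have pow: "?s ^ card (insert i S) = ?s * ?s ^ card S"
      unfolding card_insert_disjoint[OF S(2,3)] by (rule power_Suc)
    have ring: "k * ((a + s / 4 * b) * (c + s / 4 * d)) + s * k * (b / 4 * (d / 4)) =
        k * (a * c + s / 4 * (a * d + b * c) + s / 16 * (b * d)) + k * ((s / 4)\<^sup>2 * (b * d))"
      for a b c d k s :: real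
      by (simp add: power2_eq_square algebra_simps)
    have eq: "?s ^ card S * (?W' S g * ?W' S h) +
        ?s ^ card (insert i S) * (?W' (insert i S) g * ?W' (insert i S) h) =
        ?s ^ card S *
        (?W S (?m g) * ?W S (?m h) +
         ?s / 4 * (?W S (?m g) * ?W S (?d h) + ?W S (?d g) * ?W S (?m h)) +
         ?s / 16 * (?W S (?d g) * ?W S (?d h))) +
        ?s ^ card S * ((?s / 4)\<^sup>2 * (?W S (?d g) * ?W S (?d h)))"
      unfolding W' pow by (rule ring)
    have nonneg: "0 \<le> ?s ^ card S * ((?s / 4)\<^sup>2 * (?W S (?d g) * ?W S (?d h)))"
      by (intro mult_nonneg_nonneg gen_influence_nonneg zero_le_power[OF s] zero_le_power2)
    show "?s ^ card S *
        (?W S (?m g) * ?W S (?m h) +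
         ?s / 4 * (?W S (?m g) * ?W S (?d h) + ?W S (?d g) * ?W S (?m h)) +
         ?s / 16 * (?W S (?d g) * ?W S (?d h)))
      \<le> ?s ^ card S * (?W' S g * ?W' S h) +
        ?s ^ card (insert i S) * (?W' (insert i S) g * ?W' (insert i S) h)"
      unfolding eq using nonneg by (simp only: le_add_same_cancel1)
  qed
  also have "\<dots> = (\<Sum>S\<in>Pow (insert i I). ?s ^ card S * (?W' S g * ?W' S h))"
    by (rule sum_Pow_insert[OF insert.hyps, symmetric])
  finally show ?case .
qed

section \<open>The fourth-moment bound and the passage to norms\<close>

lemma global_hypercontractivity:
  fixes f :: "('i \<Rightarrow> bool) \<Rightarrow> real"
  assumes "finite I" "p \<in> {0..1}" "small_gen_influences I p \<beta> f"
  defines "M \<equiv> measure_pmf.expectation (biased_measure I p) (\<lambda>x. (f x)\<^sup>2)"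
  shows "measure_pmf.expectation (biased_measure I p) (\<lambda>x. (noise_operator I p (1 / 5) f x) ^ 4)
    \<le> \<beta> * M\<^sup>2"
proof -
  let ?s = "p * (1 - p)"
  let ?W = "\<lambda>S. gen_influence I p S (noise_operator I p (1 / 2) f)"
  have s: "0 \<le> ?s"
    using assms(2) by simp
  have W: "?W S \<le> \<beta> * M" if "S \<subseteq> I" for S
  proof -
    have "?W S \<le> gen_influence I p S f"
      by (rule gen_influence_noise_le[OF assms(1) that assms(2)]) simp
    also have "\<dots> \<le> \<beta> * M"
      using assms(3) that by (simp add: small_gen_influences_def M_def)
    finally show ?thesis .
  qed
  \<comment> \<open>The sign comes from the empty set: its noisy influence is nonnegative and at
    most \<beta> M.\<close>
  have bM: "0 \<le> \<beta> * M"
    using W[of "{}"] gen_influence_nonneg[of I p "{}" "noise_operator I p (1 / 2) f"] by simp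
  have "measure_pmf.expectation (biased_measure I p) (\<lambda>x. (noise_operator I p (1 / 5) f x) ^ 4)
      \<le> (\<Sum>S\<in>Pow I. ?s ^ card S * (?W S * ?W S))"
    using noise_product_le_sum_gen_influence[OF assms(1,2), of f f]
    by (simp add: power2_eq_square power4_eq_xxxx mult.assoc)
  also have "\<dots> \<le> (\<Sum>S\<in>Pow I. \<beta> * M * (?s ^ card S * ?W S))"
  proof (rule sum_mono)
    fix S assume "S \<in> Pow I"
    then have "?s ^ card S * ?W S * ?W S \<le> ?s ^ card S * ?W S * (\<beta> * M)"
      by (intro mult_left_mono W mult_nonneg_nonneg gen_influence_nonneg zero_le_power[OF s]) auto
    then show "?s ^ card S * (?W S * ?W S) \<le> \<beta> * M * (?s ^ card S * ?W S)"
      by (simp add: mult_ac)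
  qed
  \<comment> \<open>The rate 1/2 is admissible for the summed bound, since 2 (1/2)^2 = 1/2.\<close>
  also have "\<dots> \<le> \<beta> * M * M"
    unfolding sum_distrib_left[symmetric] M_def
    by (intro mult_left_mono sum_gen_influence_noise_le assms(1,2) bM[unfolded M_def])
      (auto simp: power2_eq_square)
  finally show ?thesis
    by (simp add: power2_eq_square mult.assoc)
qed

theorem theorem1p3:
  fixes n :: nat and p \<beta> :: real and f :: "(nat \<Rightarrow> bool) \<Rightarrow> real"
  assumes "0 < p" and "p \<le> 1 / 2"
    and "small_gen_influences {1..n} p \<beta> f"
  shows "lnorm {1..n} p 4 (noise_operator {1..n} p (1 / 5) f)
           \<le> \<beta> powr (1 / 4) * lnorm {1..n} p 2 f"
proof -
  let ?E = "measure_pmf.expectation (biased_measure {1..n} p)"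
  let ?T = "noise_operator {1..n} p (1 / 5) f"
  define M where "M = ?E (\<lambda>x. (f x)\<^sup>2)"
  have abs_powr: "\<bar>x\<bar> powr 4 = x ^ 4" "\<bar>x\<bar> powr 2 = x\<^sup>2" for x :: real
    by (simp_all add: powr_numeral)
  have lnorm: "lnorm {1..n} p 4 ?T = (?E (\<lambda>x. (?T x) ^ 4)) powr (1 / 4)"
    "lnorm {1..n} p 2 f = M powr (1 / 2)"
    unfolding lnorm_def abs_powr M_def by simp_all
  have le: "?E (\<lambda>x. (?T x) ^ 4) \<le> \<beta> * M\<^sup>2"
    unfolding M_def by (rule global_hypercontractivity) (use assms in auto)
  have nonneg: "0 \<le> ?E (\<lambda>x. (?T x) ^ 4)" "0 \<le> M"
    unfolding M_def by (auto intro: integral_nonneg_AE)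
  \<comment> \<open>The influence of the empty set is M itself, so \<beta> is at least 1 unless M =
    0; this permits splitting the power of the product. For M = 0 both sides vanish whatever \<beta>
    is.\<close>
  have "M \<le> \<beta> * M"
    using assms(3) unfolding small_gen_influences_def M_def
    by (metis gen_influence_empty empty_subsetI)
  show ?thesis
  proof (cases "M = 0")
    case True
    then have "?E (\<lambda>x. (?T x) ^ 4) = 0"
      using le nonneg(1) by (intro antisym) simp_all
    with True show ?thesis
      unfolding lnorm by simp
  next
    case False
    then have "1 \<le> \<beta>" and M: "0 < M"
      using \<open>M \<le> \<beta> * M\<close> nonneg by auto
    have "(?E (\<lambda>x. (?T x) ^ 4)) powr (1 / 4) \<le> (\<beta> * M\<^sup>2) powr (1 / 4)"
      using le nonneg by (intro powr_mono2) auto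
    also have "\<dots> = \<beta> powr (1 / 4) * (M powr 2) powr (1 / 4)"
      using \<open>1 \<le> \<beta>\<close> M by (simp add: powr_mult powr_numeral)
    also have "(M powr 2) powr (1 / 4) = M powr (1 / 2)"
      by (simp add: powr_powr)
    finally show ?thesis
      unfolding lnorm .
  qed
qed

end
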